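(* Let $y\sim\mathcal{N}(\mu,\sigma^2I_n)$, let $\hat E(y)=(\hat S,\hat s)$ be the outcome of marginal screening with model size $k$, and let $\alpha\in(0,1)$. Let an index $j\in\hat S$ and a real null value $\beta_j$ be chosen as functions of $\hat E(y)$ only (arbitrary otherwise). Then the test of $H_0:\ \beta^\star_{j\in\hat S}=\beta_j$ that accepts when $$ \frac{\alpha}{2}<F^{[\mathcal{V}^-,\mathcal{V}^+]}_{\beta_j,\ \sigma^2\|\eta_j\|_2^2}(\eta_j^Ty)<1-\frac{\alpha}{2} $$ (and rejects otherwise) is an $\alpha$ level test of $H_0$, that is, $\Pr(\text{reject } H_0\mid H_0)\le\alpha$, where conditioning on $H_0$ means conditioning on the event (determined by $\hat E(y)$) that $\beta^\star_{j\in\hat S}=\beta_j$ holds, assumed to have positive probability.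
   Context: Setting: $X\in\mathbb{R}^{n\times p}$ is a fixed (non-random) design matrix with columns $x_1,\dots,x_p\in\mathbb{R}^n$ of unit Euclidean norm, in general position: any set of at most $\min(n,p)$ columns is linearly independent, and $x_i\neq\pm x_j$ for $i\ne j$. The response is $y=\mu+\epsilon$ with $\mu\in\mathbb{R}^n$ an arbitrary fixed vector and $\epsilon\sim\mathcal{N}(0,\sigma^2 I_n)$, $\sigma^2>0$ known. The model size $k$ is a fixed integer with $1\le k\le\min(n,p)$. Marginal screening: $\hat S=\hat S(y)$ is the set of indices of the $k$ largest entries of $(|x_1^Ty|,\dots,|x_p^Ty|)$, and $\hat s\in\{\pm1\}^{\hat S}$ is given by $\hat s_i=\mathrm{sign}(x_i^Ty)$, $i\in\hat S$. (Ties and zero correlations have probability zero and may be resolved arbitrarily.) Write $\hat E(y)=(\hat S,\hat s)$. For $S\subset\{1,\dots,p\}$ with $|S|=k$, $X_S$ is the submatrix of columns indexed by $S$, $\beta^\star_S=(X_S^TX_S)^{-1}X_S^T\mu$, and $\beta^\star_{j\in S}$ is the coordinate of $\beta^\star_S$ corresponding to the variable $j\in S$. With $e_j$ the standard basis vector of $\mathbb{R}^S$ for $j\in S$, put $\eta_j=X_{\hat S}(X_{\hat S}^TX_{\hat S})^{-1}e_j=(X_{\hat S}^T)^\dagger e_j$, so that $\eta_j^T\mu=\beta^\star_{j\in\hat S}$. For $s\in\{\pm1\}^S$, $A(S,s)$ is the matrix with rows $(x_l-s_ix_i)^T$ and $(-x_l-s_ix_i)^T$ for $i\in S$, $l\notin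 S$, and $-s_ix_i^T$ for $i\in S$; $b(S,s)=0$. Thus, up to null sets, $\{\hat E(y)=(S,s)\}=\{A(S,s)y\le b(S,s)\}$. With $A=A(\hat S,\hat s)$, $b=b(\hat S,\hat s)$, $\eta=\eta_j$ and $c=A\eta/\|\eta\|_2^2$, define $$ \mathcal{V}^-=\max_{l:\,c_l<0}\frac{b_l-(Ay)_l+c_l\,\eta^Ty}{c_l},\qquad \mathcal{V}^+=\min_{l:\,c_l>0}\frac{b_l-(Ay)_l+c_l\,\eta^Ty}{c_l}, $$ with an empty max equal to $-\infty$ and an empty min equal to $+\infty$. For $-\infty\le v<w\le\infty$, $F^{[v,w]}_{m,\tau^2}$ is the CDF of the $\mathcal{N}(m,\tau^2)$ distribution truncated to $[v,w]$: $$F^{[v,w]}_{m,\tau^2}(t)=\frac{\Phi((t-m)/\tau)-\Phi((v-m)/\tau)}{\Phi((w-m)/\tau)-\Phi((v-m)/\tau)},$$ where $\Phi$ is the standard normal CDF. *)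

theory Defs
  imports "HOL-Probability.Probability"
begin

section \<open>Design matrix and least squares on a selected model\<close>

definition general_position :: "real^'p^'n \<Rightarrow> bool" where
  "general_position X \<longleftrightarrow>
     (\<forall>T. card T \<le> min CARD('n) CARD('p) \<longrightarrow> independent ((\<lambda>i. column i X) ` T)) \<and>
     (\<forall>i j. i \<noteq> j \<longrightarrow> column i X \<noteq> column j X \<and> column i X \<noteq> - column j X)"

text \<open>
  The selected model \<open>S\<close> is random, so matrices and vectors indexed by \<open>S\<close> cannot be given an
  index type of their own. They are functions on the full index type of which only the entries with
  indices in \<open>S\<close> are used.
\<close>

definition is_inverse_on :: "'i set \<Rightarrow> ('i \<Rightarrow> 'i \<Rightarrow> real) \<Rightarrow> ('i \<Rightarrow> 'i \<Rightarrow> real) \<Rightarrow> bool" where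
  "is_inverse_on S G B \<longleftrightarrow>
     (\<forall>i\<in>S. \<forall>j\<in>S. (\<Sum>l\<in>S. G i l * B l j) = (if i = j then 1 else 0)) \<and>
     (\<forall>i\<in>S. \<forall>j\<in>S. (\<Sum>l\<in>S. B i l * G l j) = (if i = j then 1 else 0))"

text \<open>
  As with \<^const>\<open>matrix_inv\<close>, the choice is only meaningful for invertible \<open>G\<close>; then the entries in
  \<open>S \<times> S\<close> are uniquely determined, while the other entries are irrelevant.
\<close>

definition inverse_on :: "'i set \<Rightarrow> ('i \<Rightarrow> 'i \<Rightarrow> real) \<Rightarrow> ('i \<Rightarrow> 'i \<Rightarrow> real)" where
  "inverse_on S G = (SOME B. is_inverse_on S G B)"

text \<open>The entries of \<open>X\<^sup>T X\<close>; restricted to \<open>S\<close>, those of \<open>X\<^sub>S\<^sup>T X\<^sub>S\<close>.\<close>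

definition gram :: "real^'p^'n \<Rightarrow> 'p \<Rightarrow> 'p \<Rightarrow> real" where
  "gram X i l = column i X \<bullet> column l X"

text \<open>Coordinate \<open>j\<close> of \<open>(X\<^sub>S\<^sup>T X\<^sub>S)\<^sup>-\<^sup>1 X\<^sub>S\<^sup>T \<mu>\<close>, for \<open>j \<in> S\<close>.\<close>

definition beta_star :: "real^'p^'n \<Rightarrow> real^'n \<Rightarrow> 'p set \<Rightarrow> 'p \<Rightarrow> real" where
  "beta_star X \<mu> S j = (\<Sum>i\<in>S. inverse_on S (gram X) j i * (column i X \<bullet> \<mu>))"

text \<open>The vector \<open>X\<^sub>S (X\<^sub>S\<^sup>T X\<^sub>S)\<^sup>-\<^sup>1 e\<^sub>j\<close>, for \<open>j \<in> S\<close>.\<close>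

definition eta :: "real^'p^'n \<Rightarrow> 'p set \<Rightarrow> 'p \<Rightarrow> real^'n" where
  "eta X S j = (\<Sum>i\<in>S. inverse_on S (gram X) i j *\<^sub>R column i X)"

section \<open>Marginal screening\<close>

text \<open>
  \<open>marginal_screening X k z (S, s)\<close> holds if \<open>(S, s)\<close> is a possible outcome for the response \<open>z\<close>:
  ties may be broken and the sign of a zero correlation may be chosen in any way. The extensional
  function space makes \<open>s\<close> carry no information outside \<open>S\<close>.
\<close>

definition marginal_screening ::
  "real^'p^'n \<Rightarrow> nat \<Rightarrow> real^'n \<Rightarrow> 'p set \<times> ('p \<Rightarrow> real) \<Rightarrow> bool" where
  "marginal_screening X k z = (\<lambda>(S, s).
     card S = k \<and>
     (\<forall>i\<in>S. \<forall>l\<in>-S. \<bar>column l X \<bullet> z\<bar> \<le> \<bar>column i X \<bullet> z\<bar>) \<and>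
     s \<in> S \<rightarrow>\<^sub>E {-1, 1} \<and>
     (\<forall>i\<in>S. column i X \<bullet> z \<noteq> 0 \<longrightarrow> s i = sgn (column i X \<bullet> z)))"

datatype 'p row = Upper 'p 'p | Lower 'p 'p | Sign 'p

definition ms_rows :: "'p set \<Rightarrow> 'p row set" where
  "ms_rows S = {Upper i l |i l. i \<in> S \<and> l \<notin> S} \<union> {Lower i l |i l. i \<in> S \<and> l \<notin> S} \<union> {Sign i |i. i \<in> S}"

text \<open>The rows of \<open>A(S, s)\<close> are those with index in \<^term>\<open>ms_rows S\<close>.\<close>

fun ms_A :: "real^'p^'n \<Rightarrow> ('p \<Rightarrow> real) \<Rightarrow> 'p row \<Rightarrow> real^'n" where
  "ms_A X s (Upper i l) = column l X - s i *\<^sub>R column i X"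
| "ms_A X s (Lower i l) = - column l X - s i *\<^sub>R column i X"
| "ms_A X s (Sign i) = - (s i *\<^sub>R column i X)"

definition ms_b :: "'p row \<Rightarrow> real" where
  "ms_b r = 0"

section \<open>Truncation limits and the truncated normal distribution\<close>

definition c_coef :: "('r \<Rightarrow> real^'n) \<Rightarrow> real^'n \<Rightarrow> 'r \<Rightarrow> real" where
  "c_coef A \<eta> r = (A r \<bullet> \<eta>) / (norm \<eta>)\<^sup>2"

text \<open>
  The row set \<open>R\<close> is finite, so the supremum and infimum below are a maximum and a minimum, except
  that they are \<open>-\<infinity>\<close> and \<open>\<infinity>\<close> if there is no row with the required sign.
\<close>

definition V_minus ::
  "'r set \<Rightarrow> ('r \<Rightarrow> real^'n) \<Rightarrow> ('r \<Rightarrow> real) \<Rightarrow> real^'n \<Rightarrow> real^'n \<Rightarrow> ereal" where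
  "V_minus R A b \<eta> z =
     (SUP r\<in>{r\<in>R. c_coef A \<eta> r < 0}.
        ereal ((b r - A r \<bullet> z + c_coef A \<eta> r * (\<eta> \<bullet> z)) / c_coef A \<eta> r))"

definition V_plus ::
  "'r set \<Rightarrow> ('r \<Rightarrow> real^'n) \<Rightarrow> ('r \<Rightarrow> real) \<Rightarrow> real^'n \<Rightarrow> real^'n \<Rightarrow> ereal" where
  "V_plus R A b \<eta> z =
     (INF r\<in>{r\<in>R. c_coef A \<eta> r > 0}.
        ereal ((b r - A r \<bullet> z + c_coef A \<eta> r * (\<eta> \<bullet> z)) / c_coef A \<eta> r))"

definition std_normal_cdf :: "ereal \<Rightarrow> real" where
  "std_normal_cdf u =
     (if u = \<infinity> then 1 else if u = -\<infinity> then 0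
      else cdf std_normal_distribution (real_of_ereal u))"

text \<open>The fourth argument is the variance \<open>\<tau>\<^sup>2\<close>, not the standard deviation.\<close>

definition trunc_normal_cdf :: "ereal \<Rightarrow> ereal \<Rightarrow> real \<Rightarrow> real \<Rightarrow> real \<Rightarrow> real" where
  "trunc_normal_cdf v w m \<tau>2 t =
     (let \<Phi> = (\<lambda>u. std_normal_cdf ((u - ereal m) / ereal (sqrt \<tau>2)))
      in (\<Phi> (ereal t) - \<Phi> v) / (\<Phi> w - \<Phi> v))"

text \<open>Density of \<open>N(\<mu>, \<sigma>\<^sup>2 I\<^sub>n)\<close>.\<close>

definition iso_normal_density :: "real^'n \<Rightarrow> real \<Rightarrow> real^'n \<Rightarrow> real" where
  "iso_normal_density \<mu> \<sigma> z =
     1 / sqrt (2 * pi * \<sigma>\<^sup>2) ^ CARD('n) * exp (- (norm (z - \<mu>))\<^sup>2 / (2 * \<sigma>\<^sup>2))"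

section \<open>The test\<close>

definition pivot ::
  "real^'p^'n \<Rightarrow> real \<Rightarrow> 'p set \<times> ('p \<Rightarrow> real) \<Rightarrow> 'p \<Rightarrow> real \<Rightarrow> real^'n \<Rightarrow> real" where
  "pivot X \<sigma> = (\<lambda>(S, s) j \<beta>\<^sub>0 z.
     let \<eta> = eta X S j
     in trunc_normal_cdf (V_minus (ms_rows S) (ms_A X s) ms_b \<eta> z)
          (V_plus (ms_rows S) (ms_A X s) ms_b \<eta> z)
          \<beta>\<^sub>0 (\<sigma>\<^sup>2 * (norm \<eta>)\<^sup>2) (\<eta> \<bullet> z))"

definition accepts ::
  "real^'p^'n \<Rightarrow> real \<Rightarrow> real \<Rightarrow> 'p set \<times> ('p \<Rightarrow> real) \<Rightarrow> 'p \<Rightarrow> real \<Rightarrow> real^'n \<Rightarrow> bool" where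
  "accepts X \<sigma> \<alpha> E j \<beta>\<^sub>0 z \<longleftrightarrow>
     \<alpha> / 2 < pivot X \<sigma> E j \<beta>\<^sub>0 z \<and> pivot X \<sigma> E j \<beta>\<^sub>0 z < 1 - \<alpha> / 2"

end

theory Submission
  imports Defs
begin

text \<open>
  For a fixed outcome \<open>(S, s)\<close> the selection event is, up to a null set, the polyhedron
  \<open>{z. A z \<le> b}\<close>. On every line in direction \<open>\<eta>\<close> the limits \<open>V\<^sup>-\<close> and \<open>V\<^sup>+\<close>
  are constant and the polyhedron is either missed or met exactly where \<open>V\<^sup>- \<le> \<eta>\<^sup>T z \<le> V\<^sup>+\<close>,
  while the density of \<open>N(\<mu>, \<sigma>\<^sup>2 I)\<close> is proportional there to the density of
  \<open>N(\<eta>\<^sup>T \<mu>, \<sigma>\<^sup>2 \<parallel>\<eta>\<parallel>\<^sup>2)\<close> at \<open>\<eta>\<^sup>T z\<close>. As \<open>\<eta>\<^sup>T \<mu>\<close> is the null value under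
  \<open>H\<^sub>0\<close>, the probability integral transform gives level \<open>\<alpha>\<close> on each line. The bound is then
  integrated over all lines and summed over the finitely many outcomes for which \<open>H\<^sub>0\<close> holds.
\<close>

section \<open>Truncated distributions on the real line\<close>

lemma normal_distribution_cdf:
  assumes "\<tau> > 0"
  shows "cdf std_normal_distribution ((t - m) / \<tau>) = cdf (density lborel (normal_density m \<tau>)) t"
proof -
  let ?N = "density lborel (normal_density m \<tau>)"
  interpret N: prob_space ?N by (rule prob_space_normal_density[OF assms])
  have "distributed ?N lborel (\<lambda>x. x) (normal_density m \<tau>)"
    by (auto simp: distributed_def distr_id2 cong: distr_cong)
  then have "distributed ?N lborel (\<lambda>x. (x - m) / \<tau>) std_normal_density"
    using N.normal_standard_normal_convert[OF assms] by simp
  then have *: "std_normal_distribution = distr ?N lborel (\<lambda>x. (x - m) / \<tau>)"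
    by (simp add: distributed_def)
  have "cdf std_normal_distribution ((t - m) / \<tau>) = measure ?N ((\<lambda>x. (x - m) / \<tau>) -` {..(t - m) / \<tau>} \<inter> space ?N)"
    unfolding cdf_def * by (subst measure_distr) auto
  also have "(\<lambda>x. (x - m) / \<tau>) -` {..(t - m) / \<tau>} \<inter> space ?N = {..t}"
    using assms by (auto simp: divide_le_cancel)
  finally show ?thesis by (simp add: cdf_def)
qed

text \<open>Every \<Phi> value in \<open>trunc_normal_cdf\<close> thus becomes the mass of a
  half-line under the unstandardised normal law. The conventions at infinite \<open>u\<close> match
  the empty and the full half-line, so infinite truncation limits need no separate treatment
  later.\<close>

lemma std_normal_cdf_standardize:
  assumes "\<tau> > 0"
  shows "std_normal_cdf ((u - ereal m) / ereal \<tau>) =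
    measure (density lborel (normal_density m \<tau>)) {t. ereal t \<le> u}"
proof -
  interpret N: prob_space "density lborel (normal_density m \<tau>)"
    by (rule prob_space_normal_density[OF assms])
  show ?thesis
  proof (cases u)
    case (real r)
    then have "{t. ereal t \<le> u} = {..r}" by auto
    then show ?thesis
      using normal_distribution_cdf[OF assms, of r m] real assms by (simp add: std_normal_cdf_def cdf_def)
  next
    case PInf
    then show ?thesis using assms N.prob_space by (simp add: std_normal_cdf_def)
  next
    case MInf
    then show ?thesis using assms by (simp add: std_normal_cdf_def)
  qed
qed

text \<open>The density is positive everywhere, so no interval of positive length is a null
  set.\<close>

lemma cdf_normal_strict_mono:
  assumes "\<tau> > 0" "a < b"
  shows "cdf (density lborel (normal_density m \<tau>)) a < cdf (density lborel (normal_density m \<tau>)) b"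
proof -
  let ?N = "density lborel (normal_density m \<tau>)"
  interpret N: prob_space ?N by (rule prob_space_normal_density[OF assms(1)])
  interpret N: real_distribution ?N by unfold_locales auto
  have "\<not> {a<..b} \<in> null_sets ?N"
  proof
    assume "{a<..b} \<in> null_sets ?N"
    then have "AE x in lborel. x \<in> {a<..b} \<longrightarrow> ennreal (normal_density m \<tau> x) = 0"
      by (subst (asm) null_sets_density_iff) auto
    then have "AE x in lborel. x \<notin> {a<..b}"
      by eventually_elim (use normal_density_pos[OF assms(1)] in \<open>force simp: not_le[symmetric] ennreal_eq_0_iff\<close>)
    then have "{a<..b} \<in> null_sets lborel"
      by (subst (asm) AE_iff_null_sets[symmetric]) auto
    then show False using assms(2) by (auto simp: null_sets_def)
  qed
  then have "measure ?N {a<..b} > 0"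
    by (simp add: null_sets_def N.emeasure_eq_measure zero_less_measure_iff)
  then show ?thesis using N.cdf_diff_eq[OF assms(2)] by simp
qed

lemma isCont_cdf_normal:
  assumes "\<tau> > 0"
  shows "isCont (cdf (density lborel (normal_density m \<tau>))) t"
proof -
  let ?N = "density lborel (normal_density m \<tau>)"
  interpret N: prob_space ?N by (rule prob_space_normal_density[OF assms(1)])
  interpret N: real_distribution ?N by unfold_locales auto
  have "{t} \<in> null_sets ?N"
    by (rule absolutely_continuousI_density[unfolded absolutely_continuous_def, THEN subsetD, of _ lborel]) auto
  then show ?thesis by (simp add: N.isCont_cdf measure_eq_0_null_sets)
qed

text \<open>Supplies quantiles: the limits 0 and 1 of the CDF bracket \<open>q\<close>, and the
  intermediate value theorem applies.\<close>

lemma (in real_distribution) cdf_eq_obtain: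
  assumes "\<And>t. isCont (cdf M) t" "0 < q" "q < 1"
  obtains t where "cdf M t = q"
proof -
  have "\<forall>\<^sub>F x in at_bot. cdf M x < q"
    using order_tendstoD(2)[OF cdf_lim_at_bot] assms by simp
  then obtain a where a: "cdf M a < q" by (auto simp: eventually_at_bot_linorder)
  have "\<forall>\<^sub>F x in at_top. cdf M x > q"
    using order_tendstoD(1)[OF cdf_lim_at_top_prob] assms by simp
  then obtain b where b: "cdf M b > q" by (auto simp: eventually_at_top_linorder)
  have "a \<le> b"
    using cdf_nondecreasing[of b a] a b by linarith
  with a b have "\<exists>x. a \<le> x \<and> x \<le> b \<and> cdf M x = q"
    by (intro IVT) (auto intro: assms)
  then show ?thesis using that by blast
qed

text \<open>Within the truncation interval, rejection confines \<open>t\<close> to two end pieces,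
  cut off where the truncated CDF equals \<alpha>/2 and 1 - \<alpha>/2. Each piece carries the
  fraction \<alpha>/2 of the mass of the interval. The product form of the bound, in place of a
  conditional probability, also covers intervals without mass.\<close>

lemma (in real_distribution) truncated_cdf_level:
  fixes v w :: ereal and \<alpha> :: real
  assumes cont: "\<And>t. isCont (cdf M) t" and strict: "strict_mono (cdf M)"
    and alpha: "0 < \<alpha>" "\<alpha> < 1"
  defines "H \<equiv> \<lambda>u. prob {t. ereal t \<le> u}"
  defines "F \<equiv> \<lambda>t. (H (ereal t) - H v) / (H w - H v)"
  shows "prob {t. v \<le> ereal t \<and> ereal t \<le> w \<and> \<not> (\<alpha> / 2 < F t \<and> F t < 1 - \<alpha> / 2)}
    \<le> \<alpha> * prob {t. v \<le> ereal t \<and> ereal t \<le> w}"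
proof -
  have Hmono: "H a \<le> H b" if "a \<le> b" for a b
    unfolding H_def using that by (intro finite_measure_mono) auto
  have Hcdf: "H (ereal t) = cdf M t" for t
    by (simp add: H_def cdf_def atMost_def)
  have sm: "a \<le> b" if "cdf M a \<le> cdf M b" for a b
    using strict_mono_less_eq[OF strict] that by simp
  have Hpt: "prob {t. ereal t < u} = H u" for u
  proof -
    \<comment> \<open>Continuity excludes atoms, so open and closed half-lines have the same mass.
      For infinite \<open>u\<close> the two coincide anyway, and the default value of
      \<open>real_of_ereal u\<close> does no harm.\<close>
    have "{real_of_ereal u} \<in> null_sets M"
      using cont[of "real_of_ereal u"] by (simp add: isCont_cdf null_sets_def emeasure_eq_measure)
    then have "AE t in M. t \<notin> {real_of_ereal u}" by (rule AE_not_in)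
    then have "AE t in M. t \<in> {t. ereal t < u} \<longleftrightarrow> t \<in> {t. ereal t \<le> u}"
      by eventually_elim (auto simp: less_le)
    then show ?thesis unfolding H_def
      by (intro finite_measure_eq_AE) auto
  qed
  have Hab: "prob {t. a \<le> ereal t \<and> ereal t \<le> b} = H b - H a" if "a \<le> b" for a b
  proof -
    have "{t. a \<le> ereal t \<and> ereal t \<le> b} = {t. ereal t \<le> b} - {t. ereal t < a}" by auto
    moreover have "prob ({t. ereal t \<le> b} - {t. ereal t < a}) = prob {t. ereal t \<le> b} - prob {t. ereal t < a}"
      using that by (intro finite_measure_Diff) auto
    ultimately show ?thesis by (simp add: Hpt) (simp add: H_def)
  qed
  show ?thesis
  proof (cases "v \<le> w \<and> H w - H v > 0")
    \<comment> \<open>Here \<open>F\<close> may divide by zero or by a negative number, but the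
      interval has no mass and both sides vanish.\<close>
    case False
    then have "prob {t. v \<le> ereal t \<and> ereal t \<le> w} = 0"
    proof (cases "v \<le> w")
      case True with False Hmono[of v w] Hab[of v w] show ?thesis by auto
    next
      case False
      then have "{t. v \<le> ereal t \<and> ereal t \<le> w} = {}" by (auto dest: order_trans)
      then show ?thesis by (simp only: measure_empty)
    qed
    moreover have "prob {t. v \<le> ereal t \<and> ereal t \<le> w \<and> \<not> (\<alpha> / 2 < F t \<and> F t < 1 - \<alpha> / 2)}
      \<le> prob {t. v \<le> ereal t \<and> ereal t \<le> w}"
      by (intro finite_measure_mono) auto
    ultimately show ?thesis by simp
  next
    case True
    define D where "D = H w - H v"
    have D: "D > 0" "v \<le> w" using True by (auto simp: D_def)
    have H01: "0 \<le> H v" "H w \<le> 1" by (auto simp: H_def)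
    have \<alpha>D: "0 < D * \<alpha> / 2" "D * \<alpha> / 2 < D" using alpha D by (auto simp: field_simps)
    have HD: "H w = H v + D" by (simp add: D_def)
    \<comment> \<open>\<open>t0\<close> and \<open>t1\<close> are the \<alpha>/2 and 1 - \<alpha>/2
      quantiles of the truncated law, expressed through the untruncated CDF.\<close>
    obtain t0 where t0: "cdf M t0 = H v + D * \<alpha> / 2"
      using cdf_eq_obtain[OF cont, of "H v + D * \<alpha> / 2"] \<alpha>D H01 HD by auto
    obtain t1 where t1: "cdf M t1 = H w - D * \<alpha> / 2"
      using cdf_eq_obtain[OF cont, of "H w - D * \<alpha> / 2"] \<alpha>D H01 HD by auto
    \<comment> \<open>\<open>t0\<close> does not fall below \<open>v\<close>, nor \<open>t1\<close>
      above \<open>w\<close>, so that \<open>Hab\<close> can measure both end pieces.\<close>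
    have vt: "v \<le> ereal t0"
    proof (rule ccontr)
      assume "\<not> v \<le> ereal t0"
      then have "ereal t0 \<le> v" by (metis linear)
      then show False using Hmono[of "ereal t0" v] t0 \<alpha>D by (simp add: Hcdf)
    qed
    have tw: "ereal t1 \<le> w"
    proof (rule ccontr)
      assume "\<not> ereal t1 \<le> w"
      then have "w \<le> ereal t1" by (metis linear)
      then show False using Hmono[of w "ereal t1"] t1 \<alpha>D by (simp add: Hcdf)
    qed
    have F: "F t = (cdf M t - H v) / D" for t by (simp add: F_def Hcdf D_def)
    have lower: "t \<le> t0" if "F t \<le> \<alpha> / 2" for t
    proof (rule sm)
      have "cdf M t - H v \<le> \<alpha> / 2 * D" using that D unfolding F by (simp only: pos_divide_le_eq)
      then show "cdf M t \<le> cdf M t0" unfolding t0 by (simp only: mult.commute[of D] times_divide_eq_left)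
    qed
    have upper: "t1 \<le> t" if "1 - \<alpha> / 2 \<le> F t" for t
    proof (rule sm)
      have "(1 - \<alpha> / 2) * D \<le> cdf M t - H v" using that D unfolding F by (simp only: pos_le_divide_eq)
      then show "cdf M t1 \<le> cdf M t" unfolding t1 HD by (simp add: algebra_simps)
    qed
    have "{t. v \<le> ereal t \<and> ereal t \<le> w \<and> \<not> (\<alpha> / 2 < F t \<and> F t < 1 - \<alpha> / 2)}
      \<subseteq> {t. v \<le> ereal t \<and> ereal t \<le> ereal t0} \<union> {t. ereal t1 \<le> ereal t \<and> ereal t \<le> w}"
    proof
      fix t assume t: "t \<in> {t. v \<le> ereal t \<and> ereal t \<le> w \<and> \<not> (\<alpha> / 2 < F t \<and> F t < 1 - \<alpha> / 2)}"
      then have "F t \<le> \<alpha> / 2 \<or> 1 - \<alpha> / 2 \<le> F t" by (simp only: mem_Collect_eq) linarith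
      then have "t \<le> t0 \<or> t1 \<le> t" using lower upper by blast
      then show "t \<in> {t. v \<le> ereal t \<and> ereal t \<le> ereal t0} \<union> {t. ereal t1 \<le> ereal t \<and> ereal t \<le> w}"
        using t by (simp only: mem_Collect_eq Un_iff ereal_less_eq) blast
    qed
    then have "prob {t. v \<le> ereal t \<and> ereal t \<le> w \<and> \<not> (\<alpha> / 2 < F t \<and> F t < 1 - \<alpha> / 2)}
      \<le> prob ({t. v \<le> ereal t \<and> ereal t \<le> ereal t0} \<union> {t. ereal t1 \<le> ereal t \<and> ereal t \<le> w})"
      by (rule finite_measure_mono) auto
    also have "\<dots> \<le> prob {t. v \<le> ereal t \<and> ereal t \<le> ereal t0} + prob {t. ereal t1 \<le> ereal t \<and> ereal t \<le> w}"
      by (rule measure_Un_le) auto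
    also have "\<dots> = \<alpha> * D"
      using t0 t1 unfolding Hab[OF vt] Hab[OF tw] Hcdf by simp
    finally show ?thesis using Hab[OF D(2)] by (simp add: D_def)
  qed
qed

lemma truncated_normal_level:
  fixes v w :: ereal and m \<tau> \<alpha> :: real
  assumes tau: "\<tau> > 0" and alpha: "0 < \<alpha>" "\<alpha> < 1"
  defines "N \<equiv> density lborel (normal_density m \<tau>)"
    and "F \<equiv> trunc_normal_cdf v w m (\<tau>\<^sup>2)"
  shows "measure N {t. v \<le> ereal t \<and> ereal t \<le> w \<and> \<not> (\<alpha> / 2 < F t \<and> F t < 1 - \<alpha> / 2)}
    \<le> \<alpha> * measure N {t. v \<le> ereal t \<and> ereal t \<le> w}"
proof -
  have "prob_space N" unfolding N_def by (rule prob_space_normal_density[OF tau])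
  then interpret real_distribution N
    by (simp add: real_distribution_def real_distribution_axioms_def N_def)
  have F: "F t = (prob {s. ereal s \<le> ereal t} - prob {s. ereal s \<le> v})
      / (prob {s. ereal s \<le> w} - prob {s. ereal s \<le> v})" for t
    using tau unfolding F_def trunc_normal_cdf_def Let_def N_def real_sqrt_abs
    by (simp only: abs_of_pos std_normal_cdf_standardize)
  have "strict_mono (cdf N)"
    unfolding N_def by (intro strict_monoI cdf_normal_strict_mono tau)
  moreover have "isCont (cdf N) t" for t
    unfolding N_def by (rule isCont_cdf_normal[OF tau])
  ultimately show ?thesis
    unfolding F by (intro truncated_cdf_level alpha)
qed

section \<open>Integration along parallel lines\<close>

lemma nn_integral_lborel_translate:
  fixes f :: "'a::euclidean_space \<Rightarrow> ennreal"
  assumes [measurable]: "f \<in> borel_measurable borel"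
  shows "(\<integral>\<^sup>+z. f (c + z) \<partial>lborel) = (\<integral>\<^sup>+z. f z \<partial>lborel)"
proof -
  have "(\<integral>\<^sup>+z. f z \<partial>lborel) = (\<integral>\<^sup>+z. f z \<partial>distr lborel borel ((+) c))"
    by (simp add: lborel_distr_plus)
  also have "\<dots> = (\<integral>\<^sup>+z. f (c + z) \<partial>lborel)"
    by (subst nn_integral_distr) auto
  finally show ?thesis ..
qed

lemma nn_integral_mono_lines:
  fixes f g :: "'a::euclidean_space \<Rightarrow> ennreal"
  assumes [measurable]: "f \<in> borel_measurable borel" "g \<in> borel_measurable borel"
    and "\<eta> \<noteq> 0"
    and le: "\<And>z. (\<integral>\<^sup>+t. f (z + t *\<^sub>R \<eta>) \<partial>lborel) \<le> (\<integral>\<^sup>+t. g (z + t *\<^sub>R \<eta>) \<partial>lborel)"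
  shows "(\<integral>\<^sup>+z. f z \<partial>lborel) \<le> (\<integral>\<^sup>+z. g z \<partial>lborel)"
proof -
  \<comment> \<open>Averaging the line integrals over a slab of width one across \<open>\<eta>\<close> gives back the full
    integral, by Tonelli and translation invariance, so that no rotation of the coordinates is needed.\<close>
  define \<psi> :: "'a \<Rightarrow> ennreal" where "\<psi> z = indicator {0..1} ((\<eta> \<bullet> z) / (\<eta> \<bullet> \<eta>))" for z
  have [measurable]: "\<psi> \<in> borel_measurable borel" unfolding \<psi>_def by measurable
  \<comment> \<open>The coordinate of \<open>z - t *\<^sub>R \<eta>\<close> along \<eta>, in units
    of the length of \<eta>, decreases at unit speed in \<open>t\<close>. Every line therefore
    spends exactly time one in the slab.\<close>
  have \<psi>_shift: "(\<integral>\<^sup>+t. \<psi> (z - t *\<^sub>R \<eta>) \<partial>lborel) = 1" for z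
  proof -
    have "\<psi> (z - t *\<^sub>R \<eta>) = indicator {(\<eta> \<bullet> z) / (\<eta> \<bullet> \<eta>) - 1..(\<eta> \<bullet> z) / (\<eta> \<bullet> \<eta>)} t" for t
      using \<open>\<eta> \<noteq> 0\<close> by (auto simp: \<psi>_def indicator_def inner_diff_right diff_divide_distrib)
    then show ?thesis by simp
  qed
  have avg: "(\<integral>\<^sup>+z. (\<integral>\<^sup>+t. h (z + t *\<^sub>R \<eta>) \<partial>lborel) * \<psi> z \<partial>lborel) = (\<integral>\<^sup>+z. h z \<partial>lborel)"
    if [measurable]: "h \<in> borel_measurable borel" for h :: "'a \<Rightarrow> ennreal"
  proof -
    have "(\<integral>\<^sup>+z. (\<integral>\<^sup>+t. h (z + t *\<^sub>R \<eta>) \<partial>lborel) * \<psi> z \<partial>lborel)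
      = (\<integral>\<^sup>+z. \<integral>\<^sup>+t. h (z + t *\<^sub>R \<eta>) * \<psi> z \<partial>lborel \<partial>lborel)"
      by (simp add: nn_integral_multc)
    also have "\<dots> = (\<integral>\<^sup>+t. \<integral>\<^sup>+z. h (z + t *\<^sub>R \<eta>) * \<psi> z \<partial>lborel \<partial>lborel)"
      by (rule lborel_pair.Fubini') measurable
    also have "\<dots> = (\<integral>\<^sup>+t. \<integral>\<^sup>+z. h z * \<psi> (z - t *\<^sub>R \<eta>) \<partial>lborel \<partial>lborel)"
    \<comment> \<open>For fixed \<open>t\<close>, translating \<open>z\<close> moves the shift from
      \<open>h\<close> to \<open>\<psi>\<close>, whose integral over \<open>t\<close> is then
      one.\<close>
    proof (rule nn_integral_cong)
      fix t :: real
      show "(\<integral>\<^sup>+z. h (z + t *\<^sub>R \<eta>) * \<psi> z \<partial>lborel) = (\<integral>\<^sup>+z. h z * \<psi> (z - t *\<^sub>R \<eta>) \<partial>lborel)"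
        using nn_integral_lborel_translate[of "\<lambda>z. h z * \<psi> (z - t *\<^sub>R \<eta>)" "t *\<^sub>R \<eta>"]
        by (simp add: add.commute)
    qed
    also have "\<dots> = (\<integral>\<^sup>+z. \<integral>\<^sup>+t. h z * \<psi> (z - t *\<^sub>R \<eta>) \<partial>lborel \<partial>lborel)"
      by (rule lborel_pair.Fubini') measurable
    also have "\<dots> = (\<integral>\<^sup>+z. h z \<partial>lborel)"
      by (simp add: nn_integral_cmult \<psi>_shift)
    finally show ?thesis .
  qed
  have "(\<integral>\<^sup>+z. (\<integral>\<^sup>+t. f (z + t *\<^sub>R \<eta>) \<partial>lborel) * \<psi> z \<partial>lborel)
    \<le> (\<integral>\<^sup>+z. (\<integral>\<^sup>+t. g (z + t *\<^sub>R \<eta>) \<partial>lborel) * \<psi> z \<partial>lborel)"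
    by (intro nn_integral_mono mult_right_mono le) auto
  then show ?thesis by (simp add: avg)
qed

section \<open>The isotropic normal distribution on a polyhedron\<close>

lemma measurable_iso_normal_density [measurable]:
  "iso_normal_density \<mu> \<sigma> \<in> borel_measurable borel"
  unfolding iso_normal_density_def[abs_def] by measurable

text \<open>Completing the square splits the squared distance from \<mu> into a part constant along
  the line and a part quadratic in \<eta> \<bullet> (z - \<mu>). The latter is the exponent of the
  normal density with mean \<eta> \<bullet> \<mu> and standard deviation \<sigma> * norm
  \<eta>.\<close>

lemma iso_normal_density_line:
  fixes \<eta> \<mu> z :: "real^'n"
  assumes "\<eta> \<noteq> 0" "\<sigma> > 0"
  obtains C where "C \<ge> 0"
    "\<And>t. iso_normal_density \<mu> \<sigma> (z + t *\<^sub>R \<eta>)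
      = C * normal_density (\<eta> \<bullet> \<mu>) (\<sigma> * norm \<eta>) (\<eta> \<bullet> z + (norm \<eta>)\<^sup>2 * t)"
proof -
  define a where "a = \<eta> \<bullet> (z - \<mu>)"
  define e where "e = (norm \<eta>)\<^sup>2"
  have e: "e > 0" "\<eta> \<bullet> \<eta> = e" using assms by (auto simp: e_def power2_norm_eq_inner)
  \<comment> \<open>the squared distance of \<open>\<mu>\<close> from the line\<close>
  define K where "K = (norm (z - \<mu>))\<^sup>2 - a\<^sup>2 / e"
  \<comment> \<open>The second root cancels the one-dimensional normalising constant; the first
    keeps the \<open>n\<close>-dimensional one.\<close>
  define C where "C = 1 / sqrt (2 * pi * \<sigma>\<^sup>2) ^ CARD('n) * sqrt (2 * pi * (\<sigma> * norm \<eta>)\<^sup>2)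
    * exp (- K / (2 * \<sigma>\<^sup>2))"
  have pos: "sqrt (2 * pi * (\<sigma> * norm \<eta>)\<^sup>2) \<noteq> 0" using assms by simp
  have "iso_normal_density \<mu> \<sigma> (z + t *\<^sub>R \<eta>)
      = C * normal_density (\<eta> \<bullet> \<mu>) (\<sigma> * norm \<eta>) (\<eta> \<bullet> z + (norm \<eta>)\<^sup>2 * t)" for t
  proof -
    have "z + t *\<^sub>R \<eta> - \<mu> = (z - \<mu>) + t *\<^sub>R \<eta>" by simp
    then have "(norm (z + t *\<^sub>R \<eta> - \<mu>))\<^sup>2 = (norm (z - \<mu>))\<^sup>2 + 2 * t * a + t\<^sup>2 * e"
      unfolding power2_norm_eq_inner
      by (simp add: inner_add_left inner_add_right a_def e(2)[symmetric] inner_commute power2_eq_square algebra_simps)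
    also have "\<dots> = K + (a + e * t)\<^sup>2 / e"
      using e by (simp add: K_def field_simps power2_eq_square)
    finally have 1: "- (norm (z + t *\<^sub>R \<eta> - \<mu>))\<^sup>2 / (2 * \<sigma>\<^sup>2)
      = - K / (2 * \<sigma>\<^sup>2) + - (a + e * t)\<^sup>2 / (2 * (\<sigma> * norm \<eta>)\<^sup>2)"
      using e assms by (simp add: power_mult_distrib e_def[symmetric] field_simps)
    have 2: "\<eta> \<bullet> z + (norm \<eta>)\<^sup>2 * t - \<eta> \<bullet> \<mu> = a + e * t"
      by (simp add: a_def e_def inner_diff_right)
    have "p * (e1 * e2) = p * q * e1 * (1 / q * e2)" if "q \<noteq> 0" for p q e1 e2 :: real
      using that by simp
    from this[OF pos] show ?thesis
      unfolding iso_normal_density_def normal_density_def 1 2 exp_add C_def .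
  qed
  moreover have "C \<ge> 0" by (simp add: C_def)
  ultimately show ?thesis using that by blast
qed

text \<open>The factor \<open>c\<close> depends on the line but not on \<open>Q\<close>. This lets
  two events on the same line be compared through their one-dimensional normal masses alone.\<close>

lemma iso_normal_line_integral:
  fixes \<eta> \<mu> z :: "real^'n"
  assumes "\<eta> \<noteq> 0" "\<sigma> > 0"
  obtains c where "\<And>Q. Q \<in> sets borel \<Longrightarrow>
    (\<integral>\<^sup>+t. ennreal (iso_normal_density \<mu> \<sigma> (z + t *\<^sub>R \<eta>)) * indicator Q (\<eta> \<bullet> (z + t *\<^sub>R \<eta>)) \<partial>lborel)
      = c * emeasure (density lborel (normal_density (\<eta> \<bullet> \<mu>) (\<sigma> * norm \<eta>))) Q"
proof -
  obtain C where C: "C \<ge> 0" "\<And>t. iso_normal_density \<mu> \<sigma> (z + t *\<^sub>R \<eta>)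
      = C * normal_density (\<eta> \<bullet> \<mu>) (\<sigma> * norm \<eta>) (\<eta> \<bullet> z + (norm \<eta>)\<^sup>2 * t)"
    using iso_normal_density_line[OF assms] by blast
  define e where "e = (norm \<eta>)\<^sup>2"
  have e: "e > 0" "\<eta> \<bullet> \<eta> = e" using assms by (auto simp: e_def power2_norm_eq_inner)
  let ?N = "density lborel (normal_density (\<eta> \<bullet> \<mu>) (\<sigma> * norm \<eta>))"
  have "(\<integral>\<^sup>+t. ennreal (iso_normal_density \<mu> \<sigma> (z + t *\<^sub>R \<eta>)) * indicator Q (\<eta> \<bullet> (z + t *\<^sub>R \<eta>)) \<partial>lborel)
      = ennreal (C / e) * emeasure ?N Q" if [measurable]: "Q \<in> sets borel" for Q
  proof -
    define F where "F u = ennreal (normal_density (\<eta> \<bullet> \<mu>) (\<sigma> * norm \<eta>) u) * indicator Q u" for u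
    have [measurable]: "F \<in> borel_measurable borel" unfolding F_def by measurable
    have "(\<integral>\<^sup>+t. ennreal (iso_normal_density \<mu> \<sigma> (z + t *\<^sub>R \<eta>)) * indicator Q (\<eta> \<bullet> (z + t *\<^sub>R \<eta>)) \<partial>lborel)
      = (\<integral>\<^sup>+t. ennreal C * F (\<eta> \<bullet> z + e * t) \<partial>lborel)"
      using C(1) e unfolding C(2) e_def[symmetric]
      by (simp add: F_def ennreal_mult inner_add_right mult.assoc mult.commute[of e])
    also have "\<dots> = ennreal C * (\<integral>\<^sup>+t. F (\<eta> \<bullet> z + e * t) \<partial>lborel)"
      by (rule nn_integral_cmult) measurable
    \<comment> \<open>Multiplying and dividing by \<open>e\<close> prepares the affine substitution
      \<open>u = \<eta> \<bullet> z + e * t\<close>.\<close>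
    also have "(\<integral>\<^sup>+t. F (\<eta> \<bullet> z + e * t) \<partial>lborel)
      = ennreal (1 / e) * (ennreal e * (\<integral>\<^sup>+t. F (\<eta> \<bullet> z + e * t) \<partial>lborel))"
      using e by (simp flip: mult.assoc ennreal_mult)
    also have "ennreal e * (\<integral>\<^sup>+t. F (\<eta> \<bullet> z + e * t) \<partial>lborel) = (\<integral>\<^sup>+u. F u \<partial>lborel)"
      using e by (subst (2) nn_integral_real_affine[where c = e and t = "\<eta> \<bullet> z"]) auto
    also have "\<dots> = emeasure ?N Q"
      by (simp add: emeasure_density F_def)
    finally show ?thesis
      using C(1) e by (simp flip: mult.assoc ennreal_mult)
  qed
  then show ?thesis using that by blast
qed

section \<open>Measurability of truncation limits, truncated CDFs and polyhedra\<close>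

lemma measurable_std_normal_cdf [measurable]: "std_normal_cdf \<in> borel_measurable borel"
proof -
  interpret real_distribution std_normal_distribution by (rule real_dist_normal_dist)
  have [measurable]: "cdf std_normal_distribution \<in> borel_measurable borel"
    by (intro borel_measurable_mono monoI cdf_nondecreasing)
  show ?thesis unfolding std_normal_cdf_def[abs_def] by measurable
qed

lemma measurable_V:
  fixes A :: "'r \<Rightarrow> real^'n"
  assumes "finite R"
  shows "V_minus R A b \<eta> \<in> borel_measurable borel" "V_plus R A b \<eta> \<in> borel_measurable borel"
proof -
  have [simp]: "countable {r \<in> R. P r}" for P using assms by (simp add: countable_finite)
  show "V_minus R A b \<eta> \<in> borel_measurable borel"
    unfolding V_minus_def[abs_def] by (intro borel_measurable_SUP) auto
  show "V_plus R A b \<eta> \<in> borel_measurable borel"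
    unfolding V_plus_def[abs_def] by (intro borel_measurable_INF) auto
qed

lemma measurable_trunc_normal_cdf [measurable (raw)]:
  assumes [measurable]: "v \<in> borel_measurable M" "w \<in> borel_measurable M" "t \<in> borel_measurable M"
  shows "(\<lambda>x. trunc_normal_cdf (v x) (w x) m \<tau>2 (t x)) \<in> borel_measurable M"
  unfolding trunc_normal_cdf_def Let_def by measurable

lemma polyhedron_in_borel:
  fixes A :: "'r \<Rightarrow> 'a::euclidean_space"
  shows "{z. \<forall>r\<in>R. A r \<bullet> z \<le> b r} \<in> sets borel"
  unfolding Collect_ball_eq by (intro borel_closed closed_INT ballI closed_halfspace_le)

section \<open>Polyhedra cut by parallel lines\<close>

text \<open>The numerators in the truncation limits involve only the part of \<open>A r\<close>
  orthogonal to \<eta>, hence do not change along \<eta>. Solving the constraint of row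
  \<open>r\<close> for \<eta> \<bullet> z gives a lower or an upper bound according to the sign of
  \<open>c_coef A \<eta> r\<close>. Rows orthogonal to \<eta> give no bound: they hold on the whole
  line or nowhere on it.\<close>

lemma polyhedron_line:
  fixes A :: "'r \<Rightarrow> real^'n"
  assumes "\<eta> \<noteq> 0"
  shows "V_minus R A b \<eta> (z + t *\<^sub>R \<eta>) = V_minus R A b \<eta> z"
    and "V_plus R A b \<eta> (z + t *\<^sub>R \<eta>) = V_plus R A b \<eta> z"
    and "(\<forall>r\<in>R. A r \<bullet> z \<le> b r) \<longleftrightarrow> (\<forall>r\<in>R. A r \<bullet> \<eta> = 0 \<longrightarrow> A r \<bullet> z \<le> b r) \<and>
      V_minus R A b \<eta> z \<le> ereal (\<eta> \<bullet> z) \<and> ereal (\<eta> \<bullet> z) \<le> V_plus R A b \<eta> z"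
proof -
  have c: "c_coef A \<eta> r * (\<eta> \<bullet> \<eta>) = A r \<bullet> \<eta>" for r
    using assms by (simp add: c_coef_def power2_norm_eq_inner)
  have eq: "b r - A r \<bullet> (z + t *\<^sub>R \<eta>) + c_coef A \<eta> r * (\<eta> \<bullet> (z + t *\<^sub>R \<eta>))
    = b r - A r \<bullet> z + c_coef A \<eta> r * (\<eta> \<bullet> z)" for r
    by (simp add: inner_add_right distrib_left mult.left_commute[of _ t] c)
  show "V_minus R A b \<eta> (z + t *\<^sub>R \<eta>) = V_minus R A b \<eta> z"
    "V_plus R A b \<eta> (z + t *\<^sub>R \<eta>) = V_plus R A b \<eta> z"
    unfolding V_minus_def V_plus_def eq by simp_all
  have c0: "A r \<bullet> \<eta> = 0 \<longleftrightarrow> c_coef A \<eta> r = 0" for r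
    using assms by (simp add: c_coef_def)
  have neg: "(b r - A r \<bullet> z + c_coef A \<eta> r * (\<eta> \<bullet> z)) / c_coef A \<eta> r \<le> \<eta> \<bullet> z \<longleftrightarrow> A r \<bullet> z \<le> b r"
    if "c_coef A \<eta> r < 0" for r
    using that by (simp add: neg_divide_le_eq mult.commute)
  have pos: "\<eta> \<bullet> z \<le> (b r - A r \<bullet> z + c_coef A \<eta> r * (\<eta> \<bullet> z)) / c_coef A \<eta> r \<longleftrightarrow> A r \<bullet> z \<le> b r"
    if "c_coef A \<eta> r > 0" for r
    using that by (simp add: pos_le_divide_eq mult.commute)
  have "V_minus R A b \<eta> z \<le> ereal (\<eta> \<bullet> z) \<longleftrightarrow> (\<forall>r\<in>R. c_coef A \<eta> r < 0 \<longrightarrow> A r \<bullet> z \<le> b r)"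
    unfolding V_minus_def SUP_le_iff using neg by auto
  moreover have "ereal (\<eta> \<bullet> z) \<le> V_plus R A b \<eta> z \<longleftrightarrow> (\<forall>r\<in>R. c_coef A \<eta> r > 0 \<longrightarrow> A r \<bullet> z \<le> b r)"
    unfolding V_plus_def le_INF_iff using pos by auto
  ultimately show "(\<forall>r\<in>R. A r \<bullet> z \<le> b r) \<longleftrightarrow> (\<forall>r\<in>R. A r \<bullet> \<eta> = 0 \<longrightarrow> A r \<bullet> z \<le> b r) \<and>
      V_minus R A b \<eta> z \<le> ereal (\<eta> \<bullet> z) \<and> ereal (\<eta> \<bullet> z) \<le> V_plus R A b \<eta> z"
    unfolding c0 by (meson linorder_less_linear)
qed

text \<open>Comparing integrals line by line replaces conditioning on the component of
  \<open>z\<close> orthogonal to \<eta>. The truncated law is centred at \<eta> \<bullet> \<mu>, the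
  mean of the statistic \<eta> \<bullet> z, which makes the one-dimensional bound
  applicable.\<close>

lemma polyhedron_level:
  fixes A :: "'r \<Rightarrow> real^'n" and b :: "'r \<Rightarrow> real" and \<mu> \<eta> :: "real^'n" and \<sigma> \<alpha> :: real
  assumes finite: "finite R" and eta: "\<eta> \<noteq> 0" and sigma: "\<sigma> > 0" and alpha: "0 < \<alpha>" "\<alpha> < 1"
  defines "F \<equiv> \<lambda>z. trunc_normal_cdf (V_minus R A b \<eta> z) (V_plus R A b \<eta> z)
      (\<eta> \<bullet> \<mu>) (\<sigma>\<^sup>2 * (norm \<eta>)\<^sup>2) (\<eta> \<bullet> z)"
    and "D \<equiv> density lborel (\<lambda>z. ennreal (iso_normal_density \<mu> \<sigma> z))"
  shows "emeasure D {z. (\<forall>r\<in>R. A r \<bullet> z \<le> b r) \<and> \<not> (\<alpha> / 2 < F z \<and> F z < 1 - \<alpha> / 2)}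
    \<le> ennreal \<alpha> * emeasure D {z. \<forall>r\<in>R. A r \<bullet> z \<le> b r}"
proof -
  note [measurable] = measurable_V[OF finite]
  have [measurable]: "F \<in> borel_measurable borel" unfolding F_def by measurable
  let ?P = "{z. \<forall>r\<in>R. A r \<bullet> z \<le> b r}"
  let ?B = "{z. (\<forall>r\<in>R. A r \<bullet> z \<le> b r) \<and> \<not> (\<alpha> / 2 < F z \<and> F z < 1 - \<alpha> / 2)}"
  have P[measurable]: "?P \<in> sets borel" by (rule polyhedron_in_borel)
  have "?B = ?P \<inter> {z. \<not> (\<alpha> / 2 < F z \<and> F z < 1 - \<alpha> / 2)}" by auto
  also have "\<dots> \<in> sets borel" by measurable
  finally have B[measurable]: "?B \<in> sets borel" .
  have D_eq: "emeasure D Q = (\<integral>\<^sup>+z. ennreal (iso_normal_density \<mu> \<sigma> z) * indicator Q z \<partial>lborel)"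
    if "Q \<in> sets borel" for Q
    unfolding D_def using that by (intro emeasure_density) auto
  have "(\<integral>\<^sup>+z. ennreal (iso_normal_density \<mu> \<sigma> z) * indicator ?B z \<partial>lborel)
    \<le> (\<integral>\<^sup>+z. ennreal \<alpha> * (ennreal (iso_normal_density \<mu> \<sigma> z) * indicator ?P z) \<partial>lborel)"
  proof (rule nn_integral_mono_lines[OF _ _ eta])
    fix z :: "real^'n"
    define v w where "v = V_minus R A b \<eta> z" and "w = V_plus R A b \<eta> z"
    define G where "G = trunc_normal_cdf v w (\<eta> \<bullet> \<mu>) ((\<sigma> * norm \<eta>)\<^sup>2)"
    have [measurable]: "G \<in> borel_measurable borel" unfolding G_def by measurable
    \<comment> \<open>\<open>QP\<close> and \<open>QB\<close> collect the values of the statistic at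
      which a line that meets the polyhedron lies in it, and lies in it with rejection.
      \<open>v\<close>, \<open>w\<close> and \<open>G\<close>, computed at the base point
      \<open>z\<close>, serve the whole line.\<close>
    define QP where "QP = {t. v \<le> ereal t \<and> ereal t \<le> w}"
    define QB where "QB = {t. v \<le> ereal t \<and> ereal t \<le> w \<and> \<not> (\<alpha> / 2 < G t \<and> G t < 1 - \<alpha> / 2)}"
    have [measurable]: "QP \<in> sets borel" "QB \<in> sets borel" unfolding QP_def QB_def by measurable
    let ?N = "density lborel (normal_density (\<eta> \<bullet> \<mu>) (\<sigma> * norm \<eta>))"
    have tau: "\<sigma> * norm \<eta> > 0" using eta sigma by simp
    interpret N: prob_space ?N by (rule prob_space_normal_density[OF tau])
    have "emeasure ?N QB \<le> ennreal \<alpha> * emeasure ?N QP"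
      using truncated_normal_level[OF tau alpha, where v = v and w = w and m = "\<eta> \<bullet> \<mu>"] alpha
      unfolding QP_def QB_def G_def N.emeasure_eq_measure
      by (simp only: ennreal_mult[symmetric] measure_nonneg ennreal_leI less_imp_le)
    moreover obtain c where c: "\<And>Q. Q \<in> sets borel \<Longrightarrow>
      (\<integral>\<^sup>+t. ennreal (iso_normal_density \<mu> \<sigma> (z + t *\<^sub>R \<eta>)) * indicator Q (\<eta> \<bullet> (z + t *\<^sub>R \<eta>)) \<partial>lborel)
      = c * emeasure ?N Q"
      using iso_normal_line_integral[OF eta sigma] by blast
    ultimately have le: "(\<integral>\<^sup>+t. ennreal (iso_normal_density \<mu> \<sigma> (z + t *\<^sub>R \<eta>)) * indicator QB (\<eta> \<bullet> (z + t *\<^sub>R \<eta>)) \<partial>lborel)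
      \<le> ennreal \<alpha> * (\<integral>\<^sup>+t. ennreal (iso_normal_density \<mu> \<sigma> (z + t *\<^sub>R \<eta>)) * indicator QP (\<eta> \<bullet> (z + t *\<^sub>R \<eta>)) \<partial>lborel)"
      by (simp add: c mult.left_commute[of "ennreal \<alpha>"] mult_left_mono)
    have F_line: "F (z + t *\<^sub>R \<eta>) = G (\<eta> \<bullet> (z + t *\<^sub>R \<eta>))" for t
      unfolding F_def G_def v_def w_def polyhedron_line(1,2)[OF eta] by (simp add: power_mult_distrib)
    have P_line: "(\<forall>r\<in>R. A r \<bullet> (z + t *\<^sub>R \<eta>) \<le> b r) \<longleftrightarrow> (\<forall>r\<in>R. A r \<bullet> \<eta> = 0 \<longrightarrow> A r \<bullet> z \<le> b r)
      \<and> \<eta> \<bullet> (z + t *\<^sub>R \<eta>) \<in> QP" for t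
      unfolding polyhedron_line(3)[OF eta, of R A "z + t *\<^sub>R \<eta>"] QP_def v_def w_def polyhedron_line(1,2)[OF eta]
      by (simp add: inner_add_right cong: imp_cong)
    show "(\<integral>\<^sup>+t. ennreal (iso_normal_density \<mu> \<sigma> (z + t *\<^sub>R \<eta>)) * indicator ?B (z + t *\<^sub>R \<eta>) \<partial>lborel)
      \<le> (\<integral>\<^sup>+t. ennreal \<alpha> * (ennreal (iso_normal_density \<mu> \<sigma> (z + t *\<^sub>R \<eta>)) * indicator ?P (z + t *\<^sub>R \<eta>)) \<partial>lborel)"
    proof (cases "\<forall>r\<in>R. A r \<bullet> \<eta> = 0 \<longrightarrow> A r \<bullet> z \<le> b r")
      case True
      have "indicator ?P (z + t *\<^sub>R \<eta>) = (indicator QP (\<eta> \<bullet> (z + t *\<^sub>R \<eta>)) :: ennreal)" for t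
        using P_line[of t] True by (simp add: indicator_def)
      moreover have "indicator ?B (z + t *\<^sub>R \<eta>) = (indicator QB (\<eta> \<bullet> (z + t *\<^sub>R \<eta>)) :: ennreal)" for t
        using P_line[of t] True F_line[of t] by (auto simp: indicator_def QB_def QP_def)
      ultimately show ?thesis using le by (simp add: nn_integral_cmult)
    next
      \<comment> \<open>A violated row orthogonal to \<eta> is violated along the whole line, which
        therefore misses the polyhedron.\<close>
      case False
      have "indicator ?B (z + t *\<^sub>R \<eta>) = (0 :: ennreal)" for t
        using P_line[of t] False by (simp add: indicator_def)
      then show ?thesis by simp
    qed
  qed measurable
  also have "\<dots> = ennreal \<alpha> * (\<integral>\<^sup>+z. ennreal (iso_normal_density \<mu> \<sigma> z) * indicator ?P z \<partial>lborel)"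
    by (rule nn_integral_cmult) measurable
  finally show ?thesis
    unfolding D_eq[OF P] D_eq[OF B] .
qed

section \<open>The least squares direction\<close>

text \<open>The vector is the residual \<open>z\<close> of \<open>f j\<close> after projection on
  the span of the others, nonzero by independence. As \<open>f j\<close> \<bullet> z = z \<bullet>
  z, division by \<open>z \<bullet> z\<close> normalises it.\<close>

lemma dual_vector_exists:
  fixes f :: "'i \<Rightarrow> 'a::euclidean_space"
  assumes indep: "independent (f ` S)" and inj: "inj_on f S" and "j \<in> S"
  obtains v where "v \<in> span (f ` S)" "\<And>i. i \<in> S \<Longrightarrow> f i \<bullet> v = (if i = j then 1 else 0)"
proof -
  let ?W = "f ` (S - {j})"
  obtain y z where yz: "y \<in> span ?W" "\<And>w. w \<in> span ?W \<Longrightarrow> orthogonal z w" "f j = y + z"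
    using orthogonal_subspace_decomp_exists[of ?W "f j"] by blast
  have W: "?W = f ` S - {f j}"
    using inj \<open>j \<in> S\<close> by (auto simp: inj_on_def)
  have "f j \<notin> span ?W"
    using indep \<open>j \<in> S\<close> unfolding W dependent_def by blast
  with yz have "z \<noteq> 0" by auto
  have "z = f j - y" using yz(3) by simp
  moreover have "y \<in> span (f ` S)"
    using yz(1) span_mono[of ?W "f ` S"] by blast
  ultimately have z: "z \<in> span (f ` S)"
    using \<open>j \<in> S\<close> by (auto intro: span_diff span_base)
  have "f i \<bullet> (z /\<^sub>R (z \<bullet> z)) = (if i = j then 1 else 0)" if "i \<in> S" for i
  proof (cases "i = j")
    case True
    have "y \<bullet> z = 0" using yz(1,2) by (simp add: orthogonal_def inner_commute)
    then show ?thesis using True yz(3) \<open>z \<noteq> 0\<close> by (simp add: inner_add_left)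
  next
    case False
    then have "orthogonal z (f i)" using that by (intro yz(2) span_base) auto
    then show ?thesis using False by (simp add: orthogonal_def inner_commute)
  qed
  moreover have "z /\<^sub>R (z \<bullet> z) \<in> span (f ` S)" using z by (rule span_scale)
  ultimately show ?thesis using that by blast
qed

text \<open>The coefficients of the dual vectors in the columns form a right inverse of the Gram
  matrix. Some inverse existing, the choice in \<open>inverse_on\<close> yields one.\<close>

lemma is_inverse_on_gram:
  fixes X :: "real^'p^'n"
  assumes indep: "independent ((\<lambda>i. column i X) ` S)" and inj: "inj_on (\<lambda>i. column i X) S"
  shows "is_inverse_on S (gram X) (inverse_on S (gram X))"
proof -
  let ?f = "\<lambda>i. column i X"
  have "\<exists>b. \<forall>i\<in>S. ?f i \<bullet> (\<Sum>l\<in>S. b l *\<^sub>R ?f l) = (if i = j then 1 else 0)"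
    if j: "j \<in> S" for j
  proof -
    obtain v where v: "v \<in> span (?f ` S)" "\<And>i. i \<in> S \<Longrightarrow> ?f i \<bullet> v = (if i = j then 1 else 0)"
      using dual_vector_exists[OF indep inj j] by blast
    obtain u where "v = (\<Sum>x\<in>?f ` S. u x *\<^sub>R x)"
      using v(1) by (subst (asm) span_finite) auto
    then have "v = (\<Sum>l\<in>S. u (?f l) *\<^sub>R ?f l)" by (simp add: sum.reindex[OF inj])
    then show ?thesis using v(2) by (intro exI[of _ "\<lambda>l. u (?f l)"]) auto
  qed
  then obtain b where b: "\<forall>j\<in>S. \<forall>i\<in>S. ?f i \<bullet> (\<Sum>l\<in>S. b j l *\<^sub>R ?f l) = (if i = j then 1 else 0)"
    using bchoice[of S "\<lambda>j b. \<forall>i\<in>S. ?f i \<bullet> (\<Sum>l\<in>S. b l *\<^sub>R ?f l) = (if i = j then 1 else 0)"] by blast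
  define v where "v j = (\<Sum>l\<in>S. b j l *\<^sub>R ?f l)" for j
  have dual: "?f i \<bullet> v j = (if i = j then 1 else 0)" if "i \<in> S" "j \<in> S" for i j
    using b that by (simp add: v_def)
  \<comment> \<open>The coefficients are themselves the Gram matrix of the dual vectors, hence
    symmetric, which turns the right inverse into a left inverse.\<close>
  have vv: "v i \<bullet> v j = b i j" if "i \<in> S" "j \<in> S" for i j
    using that by (simp add: v_def[of i] inner_sum_left dual if_distrib cong: if_cong)
  have sym: "b i j = b j i" if "i \<in> S" "j \<in> S" for i j
    using vv[OF that] vv[OF that(2,1)] by (simp add: inner_commute)
  have right: "(\<Sum>l\<in>S. gram X i l * b j l) = (if i = j then 1 else 0)" if "i \<in> S" "j \<in> S" for i j
    using dual[OF that] unfolding v_def by (simp add: inner_sum_right gram_def mult.commute)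
  have "(\<Sum>l\<in>S. b l i * gram X l j) = (if i = j then 1 else 0)" if "i \<in> S" "j \<in> S" for i j
  proof -
    have "(\<Sum>l\<in>S. b l i * gram X l j) = (\<Sum>l\<in>S. gram X j l * b i l)"
      using that by (intro sum.cong) (auto simp: sym gram_def inner_commute)
    then show ?thesis using right[OF that(2,1)] by auto
  qed
  then have "is_inverse_on S (gram X) (\<lambda>i j. b j i)"
    using right unfolding is_inverse_on_def by auto
  then show ?thesis unfolding inverse_on_def by (rule someI[of "is_inverse_on S (gram X)"])
qed

context
  fixes X :: "real^'p^'n" and S :: "'p set"
  assumes inverse: "is_inverse_on S (gram X) (inverse_on S (gram X))"
begin

lemma column_inner_eta:
  assumes "i \<in> S" "j \<in> S"
  shows "column i X \<bullet> eta X S j = (if i = j then 1 else 0)"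
  using inverse assms
  by (simp add: is_inverse_on_def eta_def inner_sum_right gram_def mult.commute)

text \<open>The entries are inner products of the vectors \<open>eta X S i\<close>, by duality with
  the columns.\<close>

lemma inverse_on_gram_symmetric:
  assumes "i \<in> S" "j \<in> S"
  shows "inverse_on S (gram X) i j = inverse_on S (gram X) j i"
proof -
  have *: "eta X S i \<bullet> eta X S j = inverse_on S (gram X) j i" if "i \<in> S" "j \<in> S" for i j
  proof -
    have "eta X S i \<bullet> eta X S j = (\<Sum>l\<in>S. inverse_on S (gram X) l i * (if l = j then 1 else 0))"
      unfolding eta_def[of X S i] inner_sum_left
      using that by (intro sum.cong) (auto simp: column_inner_eta)
    then show ?thesis using that by (simp add: if_distrib cong: if_cong)
  qed
  show ?thesis
    using *[OF assms] *[OF assms(2,1)] by (simp add: inner_commute)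
qed

lemma eta_nonzero: "j \<in> S \<Longrightarrow> eta X S j \<noteq> 0"
  using column_inner_eta[of j j] by auto

text \<open>Links the hypothesis to the mean of the test statistic. \<open>beta_star\<close> reads a
  row of the inverse and \<open>eta\<close> a column, so symmetry is what reconciles them.\<close>

lemma eta_inner_eq_beta_star:
  assumes "j \<in> S"
  shows "eta X S j \<bullet> \<mu> = beta_star X \<mu> S j"
  unfolding eta_def beta_star_def inner_sum_left
  using assms by (intro sum.cong) (auto simp: inverse_on_gram_symmetric)

end

text \<open>Independence of a set of columns does not see repetitions; injectivity comes from the
  second clause of \<open>general_position\<close>.\<close>

lemma general_position_is_inverse_on:
  fixes X :: "real^'p^'n"
  assumes "general_position X" "card S \<le> min CARD('n) CARD('p)"
  shows "is_inverse_on S (gram X) (inverse_on S (gram X))"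
  using assms unfolding general_position_def
  by (intro is_inverse_on_gram) (auto simp: inj_on_def)

section \<open>The selection event\<close>

text \<open>This direction holds for every \<open>z\<close>: ties satisfy the weak inequalities, and
  an arbitrary sign at a zero correlation still gives \<open>s i\<close> times the correlation the
  value of its modulus.\<close>

lemma marginal_screening_imp_polyhedron:
  assumes "marginal_screening X k z (S, s)"
  shows "\<forall>r\<in>ms_rows S. ms_A X s r \<bullet> z \<le> ms_b r"
proof -
  have abs: "s i * (column i X \<bullet> z) = \<bar>column i X \<bullet> z\<bar>" if "i \<in> S" for i
    using assms that by (cases "column i X \<bullet> z = 0") (auto simp: marginal_screening_def abs_sgn mult.commute)
  have le: "\<bar>column l X \<bullet> z\<bar> \<le> \<bar>column i X \<bullet> z\<bar>" if "i \<in> S" "l \<notin> S" for i l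
    using assms that by (auto simp: marginal_screening_def)
  show ?thesis
  proof
    fix r assume "r \<in> ms_rows S"
    then show "ms_A X s r \<bullet> z \<le> ms_b r"
      using le abs by (fastforce simp: ms_rows_def ms_b_def inner_diff_left abs_le_iff)
  qed
qed

text \<open>Strict inequalities exclude ties across the boundary of \<open>S\<close> and zero
  correlations within it, so no freedom of choice is left.\<close>

lemma marginal_screening_eqI:
  assumes z: "marginal_screening X k z (S', s')"
    and S: "card S = k" and s: "s \<in> S \<rightarrow>\<^sub>E {-1, 1}"
    and strict: "\<forall>r\<in>ms_rows S. ms_A X s r \<bullet> z < ms_b r"
  shows "(S', s') = (S, s)"
proof -
  have pos: "0 < s i * (column i X \<bullet> z)" if "i \<in> S" for i
    using strict that by (force simp: ms_rows_def ms_b_def)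
  have s1: "s i = -1 \<or> s i = 1" if "i \<in> S" for i using s that by auto
  have abs: "\<bar>column i X \<bullet> z\<bar> = s i * (column i X \<bullet> z)" if "i \<in> S" for i
    using pos[OF that] s1[OF that] by auto
  have less: "\<bar>column l X \<bullet> z\<bar> < \<bar>column i X \<bullet> z\<bar>" if "i \<in> S" "l \<notin> S" for i l
  proof -
    have "Upper i l \<in> ms_rows S" "Lower i l \<in> ms_rows S"
      using that by (auto simp: ms_rows_def)
    then have "ms_A X s (Upper i l) \<bullet> z < ms_b (Upper i l)" "ms_A X s (Lower i l) \<bullet> z < ms_b (Lower i l)"
      using strict by blast+
    then show ?thesis unfolding abs[OF that(1)] by (auto simp: ms_b_def inner_diff_left)
  qed
  have cards: "card S' = card S" using z S by (simp add: marginal_screening_def)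
  \<comment> \<open>If \<open>i\<close> in \<open>S\<close> were left out of \<open>S'\<close>,
    equal cardinality would put some \<open>l\<close> outside \<open>S\<close> into
    \<open>S'\<close>, and screening would rank \<open>l\<close> at least as high as
    \<open>i\<close>.\<close>
  have "S \<subseteq> S'"
  proof (rule ccontr)
    assume "\<not> S \<subseteq> S'"
    then obtain i where i: "i \<in> S" "i \<notin> S'" by auto
    have "\<not> S' \<subseteq> S"
      using cards i card_subset_eq[of S S'] by auto
    then obtain l where l: "l \<in> S'" "l \<notin> S" by auto
    have "\<bar>column i X \<bullet> z\<bar> \<le> \<bar>column l X \<bullet> z\<bar>"
      using z i l by (auto simp: marginal_screening_def)
    then show False using less[OF i(1) l(2)] by simp
  qed
  then have SS: "S' = S" using cards card_subset_eq[of S' S] by auto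
  have "s' i = s i" if "i \<in> S" for i
  proof -
    have "s' i = sgn (column i X \<bullet> z)"
      using z that pos[OF that] by (auto simp: marginal_screening_def SS)
    also have "\<dots> = s i" using pos[OF that] s1[OF that] by (auto simp: sgn_if)
    finally show ?thesis .
  qed
  moreover have "s' \<in> S \<rightarrow>\<^sub>E {-1, 1}" using z by (simp add: marginal_screening_def SS)
  ultimately have "s' = s" using s by (intro PiE_ext[of s' S _ s]) auto
  with SS show ?thesis by simp
qed

text \<open>Makes the boundary of each constraint a proper hyperplane, hence a null set. Columns
  that differ up to sign settle the comparison rows, unit norm the sign rows.\<close>

lemma ms_A_nonzero:
  fixes X :: "real^'p^'n"
  assumes unit: "\<And>i. norm (column i X) = 1" and gp: "general_position X"
    and s: "s \<in> S \<rightarrow>\<^sub>E {-1, 1}" and r: "r \<in> ms_rows S"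
  shows "ms_A X s r \<noteq> 0"
proof -
  have s1: "s i = -1 \<or> s i = 1" if "i \<in> S" for i using s that by auto
  have neq: "column i X \<noteq> column l X" "column i X \<noteq> - column l X" if "i \<noteq> l" for i l
    using gp that by (auto simp: general_position_def)
  from r consider i l where "i \<in> S" "l \<notin> S" "r = Upper i l" | i l where "i \<in> S" "l \<notin> S" "r = Lower i l"
    | i where "i \<in> S" "r = Sign i" by (auto simp: ms_rows_def)
  then show ?thesis
  proof cases
    case 1
    then have "l \<noteq> i" by auto
    then show ?thesis using 1 s1[of i] neq[of l i] by auto
  next
    case 2
    then have "l \<noteq> i" by auto
    then show ?thesis using 2 s1[of i] neq[of i l] by auto
  next
    case 3
    then show ?thesis using s1[of i] unit[of i] by auto
  qed
qed

lemma finite_ms_rows: "finite (ms_rows (S :: 'p::finite set))"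
proof -
  have "ms_rows S \<subseteq> (\<lambda>(i, l). Upper i l) ` UNIV \<union> (\<lambda>(i, l). Lower i l) ` UNIV \<union> range Sign"
    by (auto simp: ms_rows_def)
  then show ?thesis by (rule finite_subset) auto
qed

lemma AE_lborel_inner_nonzero:
  fixes a :: "'a::euclidean_space"
  assumes "a \<noteq> 0"
  shows "AE z in lborel. a \<bullet> z \<noteq> 0"
proof -
  have "negligible {z. a \<bullet> z = 0}" using assms by (intro negligible_hyperplane) auto
  moreover have "{z. a \<bullet> z = 0} \<in> sets lborel" by simp
  ultimately have "{z. a \<bullet> z = 0} \<in> null_sets lborel"
    by (simp only: negligible_iff_null_sets null_sets_completion_iff)
  then show ?thesis by (auto dest: AE_not_in)
qed

text \<open>Off the finitely many hyperplanes \<open>ms_A X s r \<bullet> z = 0\<close> the weak and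
  strict inequalities agree, and the two inclusions above meet. Membership in \<open>range E\<close>
  supplies the size of \<open>S\<close> and the range of the signs. Nothing is assumed about how
  \<open>E\<close> breaks ties.\<close>

lemma AE_marginal_screening_iff_polyhedron:
  fixes X :: "real^'p^'n"
  assumes unit: "\<And>i. norm (column i X) = 1" and gp: "general_position X"
    and E: "\<And>z. marginal_screening X k z (E z)" and e: "(S, s) \<in> range E"
  shows "AE z in lborel. E z = (S, s) \<longleftrightarrow> (\<forall>r\<in>ms_rows S. ms_A X s r \<bullet> z \<le> ms_b r)"
proof -
  obtain z0 where "marginal_screening X k z0 (S, s)" using E e by (metis rangeE)
  then have S: "card S = k" and s: "s \<in> S \<rightarrow>\<^sub>E {-1, 1}" by (auto simp: marginal_screening_def)
  have "AE z in lborel. \<forall>r\<in>ms_rows S. ms_A X s r \<bullet> z \<noteq> 0"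
    using finite_ms_rows ms_A_nonzero[OF unit gp s]
    by (intro AE_finite_allI AE_lborel_inner_nonzero) auto
  then show ?thesis
  proof eventually_elim
    case (elim z)
    show ?case
    proof
      assume "E z = (S, s)"
      then show "\<forall>r\<in>ms_rows S. ms_A X s r \<bullet> z \<le> ms_b r"
        using marginal_screening_imp_polyhedron E[of z] by metis
    next
      assume "\<forall>r\<in>ms_rows S. ms_A X s r \<bullet> z \<le> ms_b r"
      with elim have strict: "\<forall>r\<in>ms_rows S. ms_A X s r \<bullet> z < ms_b r"
        by (force simp: ms_b_def order.strict_iff_order)
      show "E z = (S, s)"
        using marginal_screening_eqI[OF _ S s strict, of "fst (E z)" "snd (E z)"] E[of z] by simp
    qed
  qed
qed

text \<open>Signs are extensional, so an outcome is one of finitely many pairs; this permits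
  summation over outcomes.\<close>

lemma finite_range_marginal_screening:
  fixes X :: "real^'p^'n"
  assumes "\<And>z. marginal_screening X k z (E z)"
  shows "finite (range E)"
proof -
  have "range E \<subseteq> (SIGMA S:UNIV. S \<rightarrow>\<^sub>E {-1, 1})"
  proof
    fix e assume "e \<in> range E"
    then obtain z where "e = E z" by blast
    with assms have "marginal_screening X k z e" by simp
    then show "e \<in> (SIGMA S:UNIV. S \<rightarrow>\<^sub>E {-1, 1})"
      by (auto simp: marginal_screening_def)
  qed
  then show ?thesis by (rule finite_subset) (auto intro!: finite_SigmaI finite_PiE)
qed

section \<open>The level for one outcome and for all outcomes together\<close>

lemma measurable_accepts [measurable]:
  fixes X :: "real^'p^'n"
  shows "Measurable.pred borel (accepts X \<sigma> \<alpha> e j \<beta>\<^sub>0)"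
proof (cases e)
  case (Pair S s)
  note [measurable] = measurable_V[OF finite_ms_rows[of S]]
  show ?thesis unfolding accepts_def pivot_def Pair Let_def prod.case by measurable
qed

text \<open>Under the hypothesis the tested value is the mean \<eta> \<bullet> \<mu>, the centre at
  which \<open>polyhedron_level\<close> applies.\<close>

lemma selected_test_level:
  fixes X :: "real^'p^'n" and \<mu> :: "real^'n" and \<sigma> \<alpha> :: real
  assumes gp: "general_position X" and S: "card S \<le> min CARD('n) CARD('p)" and j: "j \<in> S"
    and sigma: "\<sigma> > 0" and alpha: "0 < \<alpha>" "\<alpha> < 1"
    and H0: "beta_star X \<mu> S j = \<beta>\<^sub>0"
  defines "D \<equiv> density lborel (\<lambda>z. ennreal (iso_normal_density \<mu> \<sigma> z))"
  shows "emeasure D {z. (\<forall>r\<in>ms_rows S. ms_A X s r \<bullet> z \<le> ms_b r) \<and> \<not> accepts X \<sigma> \<alpha> (S, s) j \<beta>\<^sub>0 z}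
    \<le> ennreal \<alpha> * emeasure D {z. \<forall>r\<in>ms_rows S. ms_A X s r \<bullet> z \<le> ms_b r}"
proof -
  note inv = general_position_is_inverse_on[OF gp S]
  show ?thesis
    using polyhedron_level[OF finite_ms_rows[of S] eta_nonzero[OF inv j] sigma alpha,
        where A = "ms_A X s" and b = ms_b and \<mu> = \<mu>]
    unfolding D_def accepts_def pivot_def Let_def prod.case eta_inner_eq_beta_star[OF inv j] H0 .
qed

theorem theorem6p1:
  fixes X :: "real^'p^'n" and \<mu> :: "real^'n" and \<sigma> \<alpha> :: real and k :: nat
    and M :: "'a measure" and y :: "'a \<Rightarrow> real^'n"
    and E :: "real^'n \<Rightarrow> 'p set \<times> ('p \<Rightarrow> real)"
    and j :: "'p set \<times> ('p \<Rightarrow> real) \<Rightarrow> 'p"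
    and \<beta> :: "'p set \<times> ('p \<Rightarrow> real) \<Rightarrow> real"
  defines "H0 \<equiv> \<lambda>\<omega>. beta_star X \<mu> (fst (E (y \<omega>))) (j (E (y \<omega>))) = \<beta> (E (y \<omega>))"
    and "reject \<equiv> \<lambda>\<omega>. \<not> accepts X \<sigma> \<alpha> (E (y \<omega>)) (j (E (y \<omega>))) (\<beta> (E (y \<omega>))) (y \<omega>)"
  assumes unit: "\<And>i. norm (column i X) = 1"
    and gp: "general_position X"
    and sigma: "\<sigma> > 0"
    and k: "1 \<le> k" "k \<le> min CARD('n) CARD('p)"
    and alpha: "0 < \<alpha>" "\<alpha> < 1"
    and M: "prob_space M"
    and y: "distributed M lborel y (\<lambda>z. ennreal (iso_normal_density \<mu> \<sigma> z))"
    and E: "\<And>z. marginal_screening X k z (E z)"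
    and j: "\<And>z. j (E z) \<in> fst (E z)"
    and H0_pos: "\<P>(\<omega> in completion M. H0 \<omega>) > 0"
  shows "{\<omega> \<in> space M. reject \<omega>} \<in> sets (completion M) \<and>
         \<P>(\<omega> in completion M. reject \<omega> \<bar> H0 \<omega>) \<le> \<alpha>"
proof -
  interpret M: prob_space M by (rule M)
  \<comment> \<open>\<open>E\<close> may resolve ties in a non-measurable way, so its events are
    measurable only up to null sets.\<close>
  interpret C: prob_space "completion M" by (rule M.prob_space_completion)
  define D where "D = density lborel (\<lambda>z. ennreal (iso_normal_density \<mu> \<sigma> z))"
  have y_meas [measurable]: "y \<in> borel_measurable M"
    and y_distr: "distr M lborel y = D"
    using y by (auto simp: distributed_def D_def)
  interpret D: prob_space D
    unfolding y_distr[symmetric] by (rule M.prob_space_distr) simp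
  define P where "P e = {z. \<forall>r\<in>ms_rows (fst e). ms_A X (snd e) r \<bullet> z \<le> ms_b r}" for e
  \<comment> \<open>With the outcome frozen at \<open>e\<close>, the index and the null value are
    constants and the rejection region is a Borel set.\<close>
  define B where "B e = {z. \<not> accepts X \<sigma> \<alpha> e (j e) (\<beta> e) z}" for e
  have P_borel [measurable]: "P e \<in> sets borel" for e
    unfolding P_def by (rule polyhedron_in_borel)
  have B_borel [measurable]: "B e \<in> sets borel" for e
    unfolding B_def by measurable
  define Ev where "Ev e Q = {\<omega> \<in> space M. E (y \<omega>) = e \<and> y \<omega> \<in> Q}" for e Q
  have Ev_sets: "Ev e Q \<in> sets (completion M)"
    and Ev_prob: "measure (completion M) (Ev e Q) = measure D (P e \<inter> Q)"
    if e: "e \<in> range E" and Q[measurable]: "Q \<in> sets borel" for e Q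
  proof -
    let ?A = "y -` (P e \<inter> Q) \<inter> space M"
    have A: "?A \<in> sets M" "?A \<in> sets (completion M)" by (simp_all add: sets_completionI_sets)
    \<comment> \<open>The equivalence is carried from Lebesgue measure to the normal law, then along
      \<open>y\<close> to \<open>M\<close> and its completion. Completeness makes
      \<open>Ev e Q\<close> measurable, since it differs from the measurable set \<open>?A\<close>
      by a null set.\<close>
    have "AE z in lborel. E z = e \<longleftrightarrow> z \<in> P e"
      using AE_marginal_screening_iff_polyhedron[OF unit gp E, of "fst e" "snd e"] e by (simp add: P_def)
    then have "AE z in D. E z = e \<longleftrightarrow> z \<in> P e"
      unfolding D_def by (subst AE_density) (auto elim: eventually_mono)
    then have "AE \<omega> in M. E (y \<omega>) = e \<longleftrightarrow> y \<omega> \<in> P e"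
      unfolding y_distr[symmetric] by (rule AE_distrD[rotated]) simp
    then have "AE \<omega> in completion M. E (y \<omega>) = e \<longleftrightarrow> y \<omega> \<in> P e"
      by (rule AE_completion)
    then have ae: "AE \<omega> in completion M. \<omega> \<in> ?A \<longleftrightarrow> \<omega> \<in> Ev e Q"
      using AE_space by eventually_elim (auto simp: Ev_def)
    show sets: "Ev e Q \<in> sets (completion M)"
      using ae A(2) by (rule completion.in_sets_AE) (auto simp: Ev_def)
    have "measure (completion M) (Ev e Q) = measure (completion M) ?A"
      using ae A sets by (intro C.finite_measure_eq_AE) auto
    also have "\<dots> = measure M ?A" using A by simp
    also have "\<dots> = measure D (P e \<inter> Q)"
      unfolding y_distr[symmetric] by (subst measure_distr) auto
    finally show "measure (completion M) (Ev e Q) = measure D (P e \<inter> Q)" .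
  qed
  have finE: "finite (range E)" by (rule finite_range_marginal_screening[OF E])
  \<comment> \<open>Whether the hypothesis holds is decided by the outcome alone, so it is the union
    of the events of the outcomes in \<open>G\<close>.\<close>
  define G where "G = {e \<in> range E. beta_star X \<mu> (fst e) (j e) = \<beta> e}"
  have finG: "finite G" and GE: "G \<subseteq> range E" using finE by (auto simp: G_def)
  have level: "measure D (P e \<inter> B e) \<le> \<alpha> * measure D (P e)" if e: "e \<in> G" for e
  proof -
    obtain z0 where z0: "e = E z0" using e GE by blast
    have "card (fst e) = k" using E[of z0] by (auto simp: z0 marginal_screening_def split_beta)
    then have "emeasure D {z. z \<in> P e \<and> z \<in> B e} \<le> ennreal \<alpha> * emeasure D (P e)"
      using selected_test_level[OF gp, of "fst e" "j e" \<sigma> \<alpha> \<mu> "\<beta> e" "snd e"] k j[of z0] sigma alpha e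
      by (simp add: D_def P_def B_def G_def z0)
    then show ?thesis
      using alpha by (simp add: D.emeasure_eq_measure Int_def flip: ennreal_mult)
  qed
  have sum_Ev: "measure (completion M) (\<Union>e\<in>G. Ev e (Q e)) = (\<Sum>e\<in>G. measure D (P e \<inter> Q e))"
    if "\<And>e. Q e \<in> sets borel" for Q
  proof -
    have "measure (completion M) (\<Union>e\<in>G. Ev e (Q e)) = (\<Sum>e\<in>G. measure (completion M) (Ev e (Q e)))"
    proof (rule C.finite_measure_finite_Union[OF finG])
      show "(\<lambda>e. Ev e (Q e)) ` G \<subseteq> sets (completion M)"
        using GE Ev_sets that by blast
      show "disjoint_family_on (\<lambda>e. Ev e (Q e)) G"
        by (auto simp: disjoint_family_on_def Ev_def)
    qed
    also have "\<dots> = (\<Sum>e\<in>G. measure D (P e \<inter> Q e))"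
      using GE that by (intro sum.cong Ev_prob) auto
    finally show ?thesis .
  qed
  have "{\<omega> \<in> space M. reject \<omega>} = (\<Union>e\<in>range E. Ev e (B e))"
    by (auto simp: reject_def Ev_def B_def)
  also have "\<dots> \<in> sets (completion M)"
    using finE by (intro sets.finite_UN Ev_sets) auto
  finally have reject_sets: "{\<omega> \<in> space M. reject \<omega>} \<in> sets (completion M)" .
  have "{\<omega> \<in> space M. reject \<omega> \<and> H0 \<omega>} = (\<Union>e\<in>G. Ev e (B e))"
    by (auto simp: reject_def H0_def Ev_def B_def G_def)
  then have "\<P>(\<omega> in completion M. reject \<omega> \<and> H0 \<omega>) = (\<Sum>e\<in>G. measure D (P e \<inter> B e))"
    by (simp add: sum_Ev)
  also have "\<dots> \<le> (\<Sum>e\<in>G. \<alpha> * measure D (P e))"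
    by (intro sum_mono level)
  \<comment> \<open>The same decomposition with \<open>Q e = UNIV\<close> turns the bound into
    \<alpha> times the probability of the hypothesis, which is then divided out.\<close>
  also have "{\<omega> \<in> space M. H0 \<omega>} = (\<Union>e\<in>G. Ev e UNIV)"
    by (auto simp: H0_def Ev_def G_def)
  then have "(\<Sum>e\<in>G. \<alpha> * measure D (P e)) = \<alpha> * \<P>(\<omega> in completion M. H0 \<omega>)"
    by (simp add: sum_Ev sum_distrib_left)
  finally have "\<P>(\<omega> in completion M. reject \<omega> \<bar> H0 \<omega>) \<le> \<alpha>"
    using H0_pos by (simp add: cond_prob_def pos_divide_le_eq)
  with reject_sets show ?thesis ..
qed

end
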